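(* Let $T$ be a finite rooted ordered tree with root $r$. The dual $T^*$ of $T$ (defined in the context) is a well-defined rooted ordered tree with root $r$.
   Context: Trees are finite, rooted and ordered. For a node $u$, $rmc_T(u)$ denotes its rightmost child in $T$ and $ils_T(u)$ its immediate left sibling in $T$ (when these exist). The dual $T^*$ of $T$ is the directed graph on the vertex set of $T$ whose parent function $\mathsf{pa}^*$ and sibling order are given by the rules: (1a) $r$ has no parent in $T^*$; (1b) if $v=rmc_T(r)$ then $v$ is the rightmost child of $r$ in $T^*$; (2) if $v=rmc_T(u)$ with $u\ne r$, then $v$ is the immediate left sibling of $u$ in $T^*$, so $\mathsf{pa}^*(v)=\mathsf{pa}^*(u)$; (3) if $v=ils_T(u)$, then $v$ is the rightmost child of $u$ in $T^*$, so $\mathsf{pa}^*(v)=u$. These rules assign each non-root node exactly one parent and a position among the nodes sharing that parent. *)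

theory Defs
  imports Main
begin

text \<open>
  A vertex set with a parent function and a sibling order; \<open>(v, w) \<in> left G\<close> means that
  \<open>v\<close> lies strictly to the left of \<open>w\<close>.  The digraph has an arc between \<open>v\<close> and \<open>u\<close> iff
  \<open>par G v = Some u\<close>.
\<close>

record 'a sib_graph =
  verts :: "'a set"
  par :: "'a \<rightharpoonup> 'a"
  left :: "'a rel"

definition children :: "'a sib_graph \<Rightarrow> 'a \<Rightarrow> 'a set" where
  "children G u = {v. par G v = Some u}"

text \<open>
  The two inclusions on \<open>par\<close> and the one on \<open>left\<close> rule out junk values, so that equality of
  records is equality of the represented structures.  There is deliberately no requirement of
  acyclicity, of connectedness, or that vertices other than a root have a parent.
\<close>

definition sib_digraph :: "'a sib_graph \<Rightarrow> bool" where
  "sib_digraph G \<longleftrightarrow>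
     dom (par G) \<subseteq> verts G \<and> ran (par G) \<subseteq> verts G \<and>
     left G \<subseteq> (\<Union>u. children G u \<times> children G u) \<and>
     (\<forall>u. strict_linear_order_on (children G u) (left G))"

definition rooted_ordered_tree :: "'a \<Rightarrow> 'a sib_graph \<Rightarrow> bool" where
  "rooted_ordered_tree r G \<longleftrightarrow>
     sib_digraph G \<and> finite (verts G) \<and> r \<in> verts G \<and>
     dom (par G) = verts G - {r} \<and>
     (\<forall>v \<in> verts G. (v, r) \<in> {(x, y). par G x = Some y}\<^sup>*)"

definition is_rmc :: "'a sib_graph \<Rightarrow> 'a \<Rightarrow> 'a \<Rightarrow> bool" where
  "is_rmc G u v \<longleftrightarrow> v \<in> children G u \<and> (\<forall>w \<in> children G u. w \<noteq> v \<longrightarrow> (w, v) \<in> left G)"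

definition is_ils :: "'a sib_graph \<Rightarrow> 'a \<Rightarrow> 'a \<Rightarrow> bool" where
  "is_ils G u v \<longleftrightarrow> (v, u) \<in> left G \<and> \<not> (\<exists>w. (v, w) \<in> left G \<and> (w, u) \<in> left G)"

text \<open>
  \<open>is_rmc G u v\<close> and \<open>is_ils G u v\<close> express that \<open>v\<close> is the rightmost child, respectively the
  immediate left sibling, of \<open>u\<close>.  In a \<open>sib_digraph\<close>, \<open>left\<close> relates only vertices with the
  same parent, so \<open>is_ils S u v\<close> below entails that \<open>u\<close> and \<open>v\<close> have the same parent in \<open>S\<close>.
\<close>

definition is_dual :: "'a \<Rightarrow> 'a sib_graph \<Rightarrow> 'a sib_graph \<Rightarrow> bool" where
  "is_dual r T S \<longleftrightarrow>
     sib_digraph S \<and> verts S = verts T \<and>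
     par S r = None \<and>
     (\<forall>v. is_rmc T r v \<longrightarrow> is_rmc S r v) \<and>
     (\<forall>u v. is_rmc T u v \<and> u \<noteq> r \<longrightarrow> is_ils S u v) \<and>
     (\<forall>u v. is_ils T u v \<longrightarrow> is_rmc S u v)"

definition dual :: "'a \<Rightarrow> 'a sib_graph \<Rightarrow> 'a sib_graph" where
  "dual r T = (THE S. is_dual r T S)"

end

theory Submission
  imports Defs
begin

text \<open>
  Joining every non-root vertex to the vertex whose rightmost child or immediate left sibling it
  is turns a rooted ordered tree into a binary tree with two kinds of arcs.  Conversely, such a
  binary tree in which the root has no immediate left sibling determines a rooted ordered tree: the
  sibling order is the transitive closure of the sibling arcs, and the parent of a vertex is found
  by following sibling arcs to the right and then one rightmost-child arc.  Dualizing exchanges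
  the two kinds of arcs except at the root, so the dual is again given by such a binary tree.  It is
  unique because induction along the arcs determines the parents, and a strict linear
  order containing another one on the same set equals it.
\<close>

section \<open>Sibling orders and binary trees of arcs\<close>

lemma left_same_parent:
  assumes "sib_digraph G" "(v, w) \<in> left G"
  obtains u where "par G v = Some u" "par G w = Some u"
proof -
  have "(v, w) \<in> (\<Union>u. children G u \<times> children G u)"
    using assms unfolding sib_digraph_def by blast
  then show thesis using that by (auto simp only: children_def)
qed

text \<open>A pair \<open>(v, u)\<close> in \<open>I\<close> is read as \<open>v\<close> being the
  immediate left sibling of \<open>u\<close>, in \<open>R\<close> as \<open>v\<close> being the
  rightmost child of \<open>u\<close>; both point towards the root. Acyclicity of \<open>I\<close>
  is not postulated but follows from \<open>reach\<close>.\<close>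

locale binary_arcs =
  fixes V :: "'a set" and r :: 'a and I R :: "'a rel"
  assumes root_in: "r \<in> V" and finite_V: "finite V"
    and I_fun: "(v, u) \<in> I \<Longrightarrow> (v, u') \<in> I \<Longrightarrow> u = u'"
    and R_fun: "(v, u) \<in> R \<Longrightarrow> (v, u') \<in> R \<Longrightarrow> u = u'"
    and disj: "(v, u) \<in> I \<Longrightarrow> (v, u') \<notin> R"
    and I_inj: "(v, u) \<in> I \<Longrightarrow> (v', u) \<in> I \<Longrightarrow> v = v'"
    and R_inj: "(v, u) \<in> R \<Longrightarrow> (v', u) \<in> R \<Longrightarrow> v = v'"
    and root_not_right: "(v, r) \<notin> I"
    and arc_dom: "(v, u) \<in> I \<union> R \<Longrightarrow> v \<in> V - {r}"
    and arc_ran: "(v, u) \<in> R \<Longrightarrow> u \<in> V"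
    and reach: "v \<in> V \<Longrightarrow> (v, r) \<in> (I \<union> R)\<^sup>*"
begin

text \<open>Induction runs backwards along a path to the root. The extra premise
  \<open>u \<noteq> r\<close> of case \<open>sib\<close> comes from \<open>root_not_right\<close>;
  it ensures that \<open>u\<close> has a parent to share with \<open>v\<close>.\<close>

lemma vert_induct [consumes 1, case_names root sib rmc]:
  assumes "v \<in> V"
    and root: "P r"
    and sib: "\<And>v u. (v, u) \<in> I \<Longrightarrow> u \<noteq> r \<Longrightarrow> P u \<Longrightarrow> P v"
    and rmc: "\<And>v u. (v, u) \<in> R \<Longrightarrow> P u \<Longrightarrow> P v"
  shows "P v"
  using reach[OF assms(1)]
proof (induction rule: converse_rtrancl_induct)
  case base
  show ?case by (rule root)
next
  case (step v u)
  then show ?case using sib rmc root_not_right by blast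
qed

lemma ex_parent:
  assumes "v \<in> V" "v \<noteq> r"
  shows "\<exists>u. (v, u) \<in> I\<^sup>* O R"
proof -
  have "v \<noteq> r \<longrightarrow> (\<exists>u. (v, u) \<in> I\<^sup>* O R)"
    using assms(1)
  proof (induction rule: vert_induct)
    case root
    then show ?case by simp
  next
    case (sib v u)
    then show ?case by (meson converse_rtrancl_into_rtrancl relcomp.simps)
  next
    case (rmc v u)
    then show ?case by blast
  qed
  with assms(2) show ?thesis by simp
qed

text \<open>Since \<open>I\<close> is functional, a chain of sibling arcs is determined by its start
  and can stop for good at one vertex only. By \<open>disj\<close>, the source of an
  \<open>R\<close> arc is such a vertex, which makes parents unique.\<close>

lemma I_end_unique:
  assumes "(v, w) \<in> I\<^sup>*" "(v, w') \<in> I\<^sup>*" "w \<notin> Domain I" "w' \<notin> Domain I"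
  shows "w = w'"
  using assms
proof (induction rule: converse_rtrancl_induct)
  case base
  then show ?case by (meson Domain.DomainI converse_rtranclE)
next
  case (step v u)
  from \<open>(v, w') \<in> I\<^sup>*\<close> step.hyps(1) step.prems(3) have "(u, w') \<in> I\<^sup>*"
    by (metis Domain.DomainI I_fun converse_rtranclE)
  with step show ?case by blast
qed

lemma parent_unique:
  assumes "(v, u) \<in> I\<^sup>* O R" "(v, u') \<in> I\<^sup>* O R"
  shows "u = u'"
proof -
  obtain w w' where "(v, w) \<in> I\<^sup>*" "(w, u) \<in> R" "(v, w') \<in> I\<^sup>*" "(w', u') \<in> R"
    using assms by blast
  then show ?thesis
    using I_end_unique disj R_fun by (metis DomainE)
qed

text \<open>A functional chain cannot leave a cycle, yet the chain from \<open>v\<close> must reach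
  the source of an \<open>R\<close> arc.\<close>

lemma irrefl_I_trancl: "(v, v) \<notin> I\<^sup>+"
proof
  assume v: "(v, v) \<in> I\<^sup>+"
  then have "v \<in> V - {r}" using arc_dom by (meson UnI1 tranclD)
  then obtain w u where w: "(v, w) \<in> I\<^sup>*" "(w, u) \<in> R" using ex_parent by blast
  \<comment> \<open>Absence of a cycle is carried back from \<open>w\<close>, which has no outgoing
    \<open>I\<close> arc: a cycle through \<open>x\<close> would also pass through its only
    successor \<open>y\<close>.\<close>
  from w(1) have "(v, v) \<notin> I\<^sup>+"
  proof (induction rule: converse_rtrancl_induct)
    case base
    then show ?case using w(2) disj by (meson tranclD)
  next
    case (step x y)
    then show ?case by (metis I_fun rtrancl_into_trancl1 tranclD)
  qed
  with v show False by simp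
qed

text \<open>By \<open>I_inj\<close>, two chains into \<open>w\<close> agree when traced backwards
  until one of them stops.\<close>

lemma I_comparable:
  assumes "(v, w) \<in> I\<^sup>*" "(v', w) \<in> I\<^sup>*"
  shows "(v, v') \<in> I\<^sup>* \<or> (v', v) \<in> I\<^sup>*"
  using assms
proof (induction rule: rtrancl_induct)
  case base
  then show ?case by simp
next
  case (step y z)
  from step.prems show ?case
  proof (cases rule: rtranclE)
    case base
    then show ?thesis using step.hyps by (meson rtrancl.rtrancl_into_rtrancl)
  next
    case (step y')
    then show ?thesis using I_inj step.IH \<open>(y, z) \<in> I\<close> by metis
  qed
qed

section \<open>The rooted ordered tree built from the arcs\<close>

definition par_map :: "'a \<rightharpoonup> 'a" where
  "par_map v = (if v \<in> Domain (I\<^sup>* O R) then Some (THE u. (v, u) \<in> I\<^sup>* O R) else None)"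

lemma par_map_eq_Some: "par_map v = Some u \<longleftrightarrow> (v, u) \<in> I\<^sup>* O R"
proof
  assume "par_map v = Some u"
  then obtain u' where "(v, u') \<in> I\<^sup>* O R" "u = (THE u. (v, u) \<in> I\<^sup>* O R)"
    unfolding par_map_def by (auto split: if_splits)
  then show "(v, u) \<in> I\<^sup>* O R"
    using parent_unique by (metis the_equality)
next
  assume u: "(v, u) \<in> I\<^sup>* O R"
  then have "(THE u. (v, u) \<in> I\<^sup>* O R) = u"
    using parent_unique by (intro the_equality)
  with u show "par_map v = Some u" unfolding par_map_def by auto
qed

definition tree :: "'a sib_graph" where
  "tree = \<lparr>verts = V, par = par_map, left = I\<^sup>+\<rparr>"

lemma tree_simps [simp]:
  "verts tree = V" "par tree v = Some u \<longleftrightarrow> (v, u) \<in> I\<^sup>* O R" "left tree = I\<^sup>+"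
  by (simp_all add: tree_def par_map_eq_Some)

lemma children_tree: "children tree u = {v. (v, u) \<in> I\<^sup>* O R}"
  by (simp add: children_def)

lemma parent_dom: "(v, u) \<in> I\<^sup>* O R \<Longrightarrow> v \<in> V - {r}"
  by (auto elim!: converse_rtranclE[of v] dest: arc_dom[OF UnI1] arc_dom[OF UnI2])

text \<open>The path from \<open>v\<close> to its parent must start with the arc to
  \<open>u\<close>, because \<open>disj\<close> excludes an \<open>R\<close> arc at
  \<open>v\<close>; hence \<open>u\<close> has a parent too.\<close>

lemma I_ran: "(v, u) \<in> I \<Longrightarrow> u \<in> V - {r}"
proof -
  assume vu: "(v, u) \<in> I"
  then have "v \<in> V - {r}" using arc_dom by blast
  then obtain w x where "(v, w) \<in> I\<^sup>*" "(w, x) \<in> R" using ex_parent by blast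
  with vu have "(u, x) \<in> I\<^sup>* O R"
    using disj I_fun by (metis converse_rtranclE relcompI)
  then show ?thesis by (rule parent_dom)
qed

lemma dom_par_tree: "dom (par tree) = V - {r}"
proof
  show "dom (par tree) \<subseteq> V - {r}"
    using parent_dom by (metis domD subsetI tree_simps(2))
  show "V - {r} \<subseteq> dom (par tree)"
    using ex_parent by (metis DiffE domI insertI1 subsetI tree_simps(2))
qed

lemma sib_digraph_tree: "sib_digraph tree"
  unfolding sib_digraph_def
proof (intro conjI allI)
  show "dom (par tree) \<subseteq> verts tree" by (simp add: dom_par_tree)
  show "ran (par tree) \<subseteq> verts tree"
    using arc_ran by (auto simp: ran_def)
  show "left tree \<subseteq> (\<Union>u. children tree u \<times> children tree u)"
  proof clarify
    fix v w assume "(v, w) \<in> left tree"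
    then have vw: "(v, w) \<in> I\<^sup>+" by simp
    then have "w \<in> V - {r}" using I_ran by (meson tranclD2)
    then obtain u where "(w, u) \<in> I\<^sup>* O R" using ex_parent by blast
    moreover from this vw have "(v, u) \<in> I\<^sup>* O R"
      by (meson relcomp.simps rtrancl_trans trancl_into_rtrancl)
    ultimately show "(v, w) \<in> (\<Union>u. children tree u \<times> children tree u)"
      by (auto simp: children_tree)
  qed
  show "strict_linear_order_on (children tree u) (left tree)" for u
    unfolding strict_linear_order_on_def
  proof (intro conjI)
    show "trans (left tree)" by simp
    show "irrefl (left tree)" by (simp add: irrefl_def irrefl_I_trancl)
    show "total_on (children tree u) (left tree)"
    proof (rule total_onI)
      fix v v' assume "v \<in> children tree u" "v' \<in> children tree u" and ne: "v \<noteq> v'"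
      then obtain w w' where w: "(v, w) \<in> I\<^sup>*" "(v', w') \<in> I\<^sup>*" "(w, u) \<in> R" "(w', u) \<in> R"
        by (auto simp only: children_tree)
      \<comment> \<open>The chains of all children of \<open>u\<close> end in the one source of an
        \<open>R\<close> arc into \<open>u\<close>, so they are comparable.\<close>
      then have "w' = w" using R_inj by blast
      with w have "(v, v') \<in> I\<^sup>* \<or> (v', v) \<in> I\<^sup>*" using I_comparable by blast
      with ne show "(v, v') \<in> left tree \<or> (v', v) \<in> left tree"
        by (auto simp: rtrancl_eq_or_trancl)
    qed
  qed
qed

lemma rooted_ordered_tree_tree: "rooted_ordered_tree r tree"
  unfolding rooted_ordered_tree_def
proof (intro conjI ballI)
  show "sib_digraph tree" by (rule sib_digraph_tree)
  show "finite (verts tree)" "r \<in> verts tree" by (simp_all add: finite_V root_in)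
  show "dom (par tree) = verts tree - {r}" by (simp add: dom_par_tree)
  let ?P = "{(x, y). par tree x = Some y}"
  fix v assume "v \<in> verts tree"
  then have "v \<in> V" by simp
  then show "(v, r) \<in> ?P\<^sup>*"
  proof (induction rule: vert_induct)
    case root
    then show ?case by simp
  next
    case (sib v u)
    \<comment> \<open>As \<open>u \<noteq> r\<close>, its path has a first step, to a parent
      \<open>x\<close> that \<open>v\<close> shares.\<close>
    then obtain x where x: "(u, x) \<in> ?P" "(x, r) \<in> ?P\<^sup>*"
      by (meson converse_rtranclE)
    then have "(v, x) \<in> ?P"
      using sib.hyps(1) by (auto intro: converse_rtrancl_into_rtrancl)
    with x(2) show ?case by (rule converse_rtrancl_into_rtrancl[rotated])
  next
    case (rmc v u)
    then have "(v, u) \<in> ?P" by auto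
    with rmc show ?case by (meson converse_rtrancl_into_rtrancl)
  qed
qed

lemma is_rmc_tree: "(v, u) \<in> R \<Longrightarrow> is_rmc tree u v"
  unfolding is_rmc_def children_tree
proof (intro conjI ballI impI)
  assume vu: "(v, u) \<in> R"
  then show "v \<in> {v. (v, u) \<in> I\<^sup>* O R}" by blast
  fix w assume "w \<in> {v. (v, u) \<in> I\<^sup>* O R}" "w \<noteq> v"
  then obtain x where "(w, x) \<in> I\<^sup>*" "(x, u) \<in> R" by blast
  moreover from this vu have "x = v" using R_inj by blast
  ultimately show "(w, v) \<in> left tree" using \<open>w \<noteq> v\<close> by (simp add: rtrancl_eq_or_trancl)
qed

text \<open>Every nonempty chain from \<open>v\<close> begins with the arc to \<open>u\<close>, so a
  vertex strictly between them would put \<open>u\<close> on a cycle.\<close>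

lemma is_ils_tree: 
  assumes "(v, u) \<in> I"
  shows "is_ils tree u v"
proof -
  have False if "(v, w) \<in> I\<^sup>+" "(w, u) \<in> I\<^sup>+" for w
  proof -
    from that(1) assms have "(u, w) \<in> I\<^sup>*" using I_fun by (metis tranclD)
    with that(2) have "(u, u) \<in> I\<^sup>+" by simp
    then show False by (simp add: irrefl_I_trancl)
  qed
  with assms show ?thesis unfolding is_ils_def by auto
qed

lemma tree_unique:
  assumes S: "sib_digraph S" "verts S = V" "par S r = None"
    and rmc: "\<And>v u. (v, u) \<in> R \<Longrightarrow> is_rmc S u v"
    and ils: "\<And>v u. (v, u) \<in> I \<Longrightarrow> is_ils S u v"
  shows "S = tree"
proof -
  have lin: "\<And>u. strict_linear_order_on (children S u) (left S)"
    and left_sub: "left S \<subseteq> (\<Union>u. children S u \<times> children S u)"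
    and dom: "dom (par S) \<subseteq> V"
    using S unfolding sib_digraph_def by auto
  have sub: "I\<^sup>+ \<subseteq> left S"
  proof -
    have "I \<subseteq> left S" using ils by (auto simp: is_ils_def)
    moreover have "trans (left S)" using lin by (simp add: strict_linear_order_on_def)
    ultimately show ?thesis by (metis trancl_id trancl_mono subrelI)
  qed
  have par: "par S v = par tree v" for v
  proof (cases "v \<in> V")
    case True
    then show ?thesis
    proof (induction rule: vert_induct)
      case root
      have "par tree r = None" using dom_par_tree by blast
      then show ?case using S(3) by simp
    next
      case (sib v u)
      have vu: "(v, u) \<in> left S" "(v, u) \<in> left tree"
        using sub sib.hyps by auto
      have "par S v = par S u" using left_same_parent[OF S(1) vu(1)] by metis
      moreover have "par tree v = par tree u"
        using left_same_parent[OF sib_digraph_tree vu(2)] by metis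
      ultimately show ?case using sib.IH by (simp only:)
    next
      case (rmc v u)
      have "par S v = Some u" "par tree v = Some u"
        using assms(4)[OF rmc.hyps] is_rmc_tree[OF rmc.hyps]
        by (simp_all only: is_rmc_def children_def mem_Collect_eq)
      then show ?case by (simp only:)
    qed
  \<comment> \<open>Outside \<open>V\<close> both parent maps are \<open>None\<close>, so they agree
    as functions.\<close>
  next
    case False
    then show ?thesis using dom dom_par_tree by (metis Diff_iff domIff subsetD)
  qed
  \<comment> \<open>Totality of \<open>I\<^sup>+\<close> on the common children orders
    \<open>v\<close> and \<open>w\<close>; the reversed order would lie in \<open>left S\<close> by
    \<open>sub\<close>, against asymmetry.\<close>
  have "left S \<subseteq> I\<^sup>+"
  proof (rule subrelI)
    fix v w assume vw: "(v, w) \<in> left S"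
    then obtain u where u: "v \<in> children S u" "w \<in> children S u" using left_sub by auto
    then have "v \<in> children tree u" "w \<in> children tree u" unfolding children_def par .
    moreover have "total_on (children tree u) (I\<^sup>+)"
      using sib_digraph_tree by (simp add: sib_digraph_def strict_linear_order_on_def)
    moreover have "v \<noteq> w" "(w, v) \<notin> left S"
      using vw lin by (auto simp: strict_linear_order_on_def irrefl_def dest: transD)
    ultimately show "(v, w) \<in> I\<^sup>+" using sub by (meson subsetD total_on_def)
  qed
  with sub par S(2) show ?thesis by (intro sib_graph.equality) auto
qed

end

section \<open>Rightmost-child and left-sibling arcs of a rooted ordered tree\<close>

locale ordered_tree =
  fixes T :: "'a sib_graph" and r :: 'a
  assumes rooted: "rooted_ordered_tree r T"
begin

lemma finite_verts: "finite (verts T)"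
  using rooted unfolding rooted_ordered_tree_def by (elim conjE)

lemma root_in_verts: "r \<in> verts T"
  using rooted unfolding rooted_ordered_tree_def by (elim conjE)

lemma dom_par: "dom (par T) = verts T - {r}"
  using rooted unfolding rooted_ordered_tree_def by (elim conjE)

lemma reach_par: "v \<in> verts T \<Longrightarrow> (v, r) \<in> {(x, y). par T x = Some y}\<^sup>*"
  using rooted unfolding rooted_ordered_tree_def by (elim conjE) (rule bspec)

lemma sib_digraph: "sib_digraph T"
  using rooted unfolding rooted_ordered_tree_def by (elim conjE)

lemmas left_same_parent = left_same_parent[OF sib_digraph]

lemma left_linear: "strict_linear_order_on (children T u) (left T)"
  using sib_digraph unfolding sib_digraph_def by blast

lemma trans_left: "trans (left T)"
  using left_linear unfolding strict_linear_order_on_def by blast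

lemma irrefl_left: "(v, v) \<notin> left T"
  using left_linear unfolding strict_linear_order_on_def irrefl_def by blast

lemma asym_left: "(v, w) \<in> left T \<Longrightarrow> (w, v) \<notin> left T"
  using irrefl_left trans_left by (meson transD)

lemma left_total:
  assumes "par T v = Some u" "par T w = Some u" "v \<noteq> w"
  shows "(v, w) \<in> left T \<or> (w, v) \<in> left T"
proof -
  have "total_on (children T u) (left T)"
    using left_linear by (simp add: strict_linear_order_on_def)
  with assms show ?thesis by (simp add: total_on_def children_def)
qed

lemma finite_left: "finite (left T)"
proof (rule finite_subset)
  show "left T \<subseteq> verts T \<times> verts T"
    using dom_par by (auto elim!: left_same_parent)
  show "finite (verts T \<times> verts T)" using finite_verts by simp
qed

text \<open>Finiteness enters here. The first fact selects the nearest right sibling; the second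
  allows induction with the hypothesis for siblings further right.\<close>

lemma wf_left: "wf (left T)" and wf_left_converse: "wf ((left T)\<inverse>)"
proof -
  have "acyclic (left T)" using trans_left irrefl_left by (simp add: acyclic_def)
  then show "wf (left T)" "wf ((left T)\<inverse>)"
    using finite_left by (auto intro: finite_acyclic_wf finite_acyclic_wf_converse)
qed

text \<open>Of two candidates, which are comparable siblings, the left one would lie between
  \<open>v\<close> and the other.\<close>

lemma ils_fun:
  assumes "is_ils T u v" "is_ils T u' v"
  shows "u = u'"
proof (rule ccontr)
  assume "u \<noteq> u'"
  moreover obtain p where "par T v = Some p" "par T u = Some p"
    using assms left_same_parent unfolding is_ils_def by metis
  moreover obtain p' where "par T v = Some p'" "par T u' = Some p'"
    using assms left_same_parent unfolding is_ils_def by metis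
  ultimately have "(u, u') \<in> left T \<or> (u', u) \<in> left T" by (intro left_total) auto
  with assms show False unfolding is_ils_def by blast
qed

lemma ils_inj:
  assumes "is_ils T u v" "is_ils T u v'"
  shows "v = v'"
proof (rule ccontr)
  assume "v \<noteq> v'"
  moreover obtain p where "par T v = Some p" "par T u = Some p"
    using assms left_same_parent unfolding is_ils_def by metis
  moreover obtain p' where "par T v' = Some p'" "par T u = Some p'"
    using assms left_same_parent unfolding is_ils_def by metis
  ultimately have "(v, v') \<in> left T \<or> (v', v) \<in> left T" by (intro left_total) auto
  with assms show False unfolding is_ils_def by blast
qed

lemma rmc_fun: "is_rmc T u v \<Longrightarrow> is_rmc T u' v \<Longrightarrow> u = u'"
  by (simp add: is_rmc_def children_def)

lemma rmc_inj: "is_rmc T u v \<Longrightarrow> is_rmc T u v' \<Longrightarrow> v = v'"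
  unfolding is_rmc_def using asym_left by metis

lemma ils_not_rmc: "is_ils T u v \<Longrightarrow> \<not> is_rmc T u' v"
  unfolding is_rmc_def is_ils_def children_def
  using asym_left irrefl_left by (metis left_same_parent mem_Collect_eq)

lemma not_ils_root: "\<not> is_ils T r v"
  unfolding is_ils_def using dom_par by (metis DiffD2 domI left_same_parent singletonI)

text \<open>A child that is not rightmost has right siblings, and a minimal one among them is its
  immediate right neighbour.\<close>

lemma ex_rmc_or_ils:
  assumes "par T v = Some p" "\<not> is_rmc T p v"
  shows "\<exists>u. is_ils T u v"
proof -
  obtain w where "par T w = Some p" "w \<noteq> v" "(w, v) \<notin> left T"
    using assms by (auto simp: is_rmc_def children_def)
  then have "w \<in> {w. (v, w) \<in> left T}" using assms(1) left_total by blast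
  then obtain u where "(v, u) \<in> left T" "\<And>y. (y, u) \<in> left T \<Longrightarrow> (v, y) \<notin> left T"
    using wfE_min[OF wf_left] by (metis mem_Collect_eq)
  then show ?thesis unfolding is_ils_def by blast
qed

text \<open>A single parent step is replaced by moving right, neighbour by neighbour, to the
  rightmost child and then up.\<close>

lemma par_in_arcs:
  assumes "par T v = Some p"
  shows "(v, p) \<in> {(v, u). is_rmc T u v \<or> is_ils T u v}\<^sup>*"
  using wf_left_converse assms
proof (induction v rule: wf_induct_rule)
  case (less v)
  show ?case
  proof (cases "is_rmc T p v")
    case True
    then show ?thesis by (simp add: r_into_rtrancl)
  next
    case False
    then obtain u where u: "is_ils T u v" using ex_rmc_or_ils less.prems by blast
    then have vu: "(v, u) \<in> left T" by (simp add: is_ils_def)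
    then have "par T u = Some p" using less.prems by (metis left_same_parent)
    with vu less.IH have "(u, p) \<in> {(v, u). is_rmc T u v \<or> is_ils T u v}\<^sup>*" by simp
    with u show ?thesis by (intro converse_rtrancl_into_rtrancl[of v u]) auto
  qed
qed

lemma reach_arcs:
  assumes "v \<in> verts T"
  shows "(v, r) \<in> {(v, u). is_rmc T u v \<or> is_ils T u v}\<^sup>*"
proof -
  have "{(x, y). par T x = Some y} \<subseteq> {(v, u). is_rmc T u v \<or> is_ils T u v}\<^sup>*"
    using par_in_arcs by blast
  then show ?thesis using reach_par[OF assms] rtrancl_subset_rtrancl by blast
qed

section \<open>Exchanging the arcs and identifying the dual\<close>

definition dual_sib :: "'a rel" where
  "dual_sib = {(v, u). is_rmc T u v \<and> u \<noteq> r}"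

text \<open>The arc into \<open>r\<close> keeps its kind: having no parent in the dual,
  \<open>r\<close> can have no left sibling there.\<close>

definition dual_rmc :: "'a rel" where
  "dual_rmc = {(v, u). is_ils T u v \<or> u = r \<and> is_rmc T r v}"

text \<open>Only the kinds of the arcs change, so reachability of the root carries over from
  \<open>T\<close>.\<close>

lemma dual_arcs: "dual_sib \<union> dual_rmc = {(v, u). is_rmc T u v \<or> is_ils T u v}"
  by (auto simp: dual_sib_def dual_rmc_def)

sublocale dual: binary_arcs "verts T" r dual_sib dual_rmc
proof
  show "r \<in> verts T" "finite (verts T)" by (rule root_in_verts, rule finite_verts)
  show "u = u'" if "(v, u) \<in> dual_sib" "(v, u') \<in> dual_sib" for v u u'
    using that rmc_fun by (auto simp: dual_sib_def)
  show "u = u'" if "(v, u) \<in> dual_rmc" "(v, u') \<in> dual_rmc" for v u u'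
    using that ils_fun ils_not_rmc by (auto simp: dual_rmc_def)
  show "(v, u') \<notin> dual_rmc" if "(v, u) \<in> dual_sib" for v u u'
    using that rmc_fun ils_not_rmc by (auto simp: dual_sib_def dual_rmc_def)
  show "v = v'" if "(v, u) \<in> dual_sib" "(v', u) \<in> dual_sib" for v v' u
    using that rmc_inj by (auto simp: dual_sib_def)
  \<comment> \<open>The two sources of \<open>dual_rmc\<close> arcs cannot meet at \<open>r\<close>,
    since \<open>not_ils_root\<close> leaves only the rightmost child there.\<close>
  show "v = v'" if "(v, u) \<in> dual_rmc" "(v', u) \<in> dual_rmc" for v v' u
    using that ils_inj rmc_inj not_ils_root by (auto simp: dual_rmc_def)
  show "(v, r) \<notin> dual_sib" for v by (simp add: dual_sib_def)
  show "v \<in> verts T - {r}" if "(v, u) \<in> dual_sib \<union> dual_rmc" for v u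
  proof -
    from that have "v \<in> dom (par T)"
      unfolding dual_arcs by (auto simp: is_rmc_def is_ils_def children_def elim!: left_same_parent)
    then show ?thesis by (simp add: dom_par)
  qed
  show "u \<in> verts T" if "(v, u) \<in> dual_rmc" for v u
  proof -
    from that have "u \<in> dom (par T) \<or> u = r"
      by (auto simp: dual_rmc_def is_ils_def elim!: left_same_parent)
    then show ?thesis using dom_par root_in_verts by auto
  qed
  show "(v, r) \<in> (dual_sib \<union> dual_rmc)\<^sup>*" if "v \<in> verts T" for v
    using reach_arcs[OF that] by (simp add: dual_arcs)
qed

text \<open>The rules for the dual prescribe exactly the sibling and rightmost-child arcs of
  \<open>S\<close>, so \<open>tree_unique\<close> applies. This settles existence, uniqueness and
  the value of the definite description at once.\<close>

lemma is_dual_iff: "is_dual r T S \<longleftrightarrow> S = dual.tree"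
proof
  assume "is_dual r T S"
  then show "S = dual.tree"
    by (intro dual.tree_unique) (auto simp: is_dual_def dual_sib_def dual_rmc_def)
next
  have sib: "(v, u) \<in> dual_sib" if "is_rmc T u v" "u \<noteq> r" for u v
    using that by (simp add: dual_sib_def)
  have rmc: "(v, u) \<in> dual_rmc" if "is_ils T u v \<or> u = r \<and> is_rmc T r v" for u v
    using that by (simp add: dual_rmc_def)
  have "par dual.tree r = None" using dual.dom_par_tree by blast
  then have "is_dual r T dual.tree"
    unfolding is_dual_def
    using sib rmc dual.sib_digraph_tree dual.is_rmc_tree dual.is_ils_tree by simp
  then show "is_dual r T S" if "S = dual.tree" using that by simp
qed

end

theorem theorem2:
  fixes T :: "'a sib_graph" and r :: 'a
  assumes "rooted_ordered_tree r T"
  shows "(\<exists>!S. is_dual r T S) \<and> rooted_ordered_tree r (dual r T)"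
proof -
  interpret ordered_tree T r by unfold_locales (rule assms)
  have "Defs.dual r T = dual.tree" by (simp add: dual_def is_dual_iff)
  then show ?thesis using is_dual_iff dual.rooted_ordered_tree_tree by simp
qed

end
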